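(* Let $p\ge 7$ be a prime and let $N,R,n,r$ be non-negative integers with $N\ge R$ and $n<p$, $r<p$. (a) If $r\le n$, then, as a congruence of $p$-integral rational numbers, $$\binom{Np^3+n}{Rp^3+r}\Big/\Big[\binom{N}{R}\binom{n}{r}\Big]\equiv 1+c(N,R,n,r;p)\,p^3\pmod{p^5},$$ where $c(N,R,n,r;p)=H_1(n)N-H_1(r)R+\big(w_pNR-H_1(n-r)\big)(N-R)$. (b) If $n<r$, then $$\binom{Np^3+n}{Rp^3+r}\Big/\binom{N}{R}\equiv (-1)^{r-n+1}\,\frac{N-R}{r}\,\binom{r-1}{n}^{-1}p^3\pmod{p^5}.$$
   Context: For a non-negative integer $m$, $H_1(m)=\sum_{k=1}^{m}\frac1k$ (with $H_1(0)=0$); for $m<p$ this is $p$-integral. For a prime $p\ge5$, Wolstenholme's theorem gives $H_1(p-1)\equiv0\pmod{p^2}$, and $w_p$ denotes the unique integer with $0\le w_p<p^2$ and $w_p\equiv H_1(p-1)/p^2\pmod{p^2}$. *)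

theory Defs
  imports Complex_Main "HOL-Computational_Algebra.Primes"
begin

definition H1 :: "nat \<Rightarrow> rat" where
  "H1 m = (\<Sum>k=1..m. 1 / of_nat k)"

definition p_integral :: "nat \<Rightarrow> rat \<Rightarrow> bool" where
  "p_integral p x \<longleftrightarrow> \<not> int p dvd snd (quotient_of x)"

(* x = y (mod p^k) in the ring of p-integral rationals; p-integrality of both sides
   is part of the assertion. *)
definition pcong :: "nat \<Rightarrow> nat \<Rightarrow> rat \<Rightarrow> rat \<Rightarrow> bool" where
  "pcong p k x y \<longleftrightarrow> p_integral p x \<and> p_integral p y \<and>
     (\<exists>z. p_integral p z \<and> x - y = of_nat p ^ k * z)"

(* Only meaningful for primes p >= 5, where the quotient is p-integral by
   Wolstenholme's theorem. *)
definition wolst :: "nat \<Rightarrow> int" where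
  "wolst p = (THE w. 0 \<le> w \<and> w < int p ^ 2 \<and>
     pcong p 2 (of_int w) (H1 (p - 1) / of_nat p ^ 2))"

definition c_coeff :: "nat \<Rightarrow> nat \<Rightarrow> nat \<Rightarrow> nat \<Rightarrow> nat \<Rightarrow> rat" where
  "c_coeff N R n r p = H1 n * of_nat N - H1 r * of_nat R
     + (of_int (wolst p) * of_nat N * of_nat R - H1 (n - r)) * (of_nat N - of_nat R)"

end

theory Submission
  imports Defs "HOL-Number_Theory.Residue_Primitive_Roots"
begin

text \<open>
  Call \<open>u\<close> a unit with coefficient \<open>a\<close> if \<open>u \<equiv> 1 + a p\<^sup>3\<close> modulo \<open>p\<^sup>5\<close>; coefficients add up when
  such units are multiplied. Splitting \<open>(N p)!\<close> into blocks of length \<open>p\<close> writes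
  \<open>(N p choose R p) / (N choose R)\<close> as a quotient of products of \<open>G j = (j p + p - 1 choose p - 1)\<close>,
  the product of the \<open>1 + j p / k\<close> with \<open>0 < k < p\<close>. Pairing \<open>k\<close> with \<open>p - k\<close> shows that \<open>(G j)\<^sup>2\<close> is
  the product of the \<open>1 + j (j + 1) p\<^sup>2 / (k (p - k))\<close>, whose second elementary symmetric term is
  divisible by \<open>p\<^sup>5\<close> because the sums of \<open>k\<^sup>-\<^sup>2\<close> and \<open>k\<^sup>-\<^sup>4\<close> vanish modulo \<open>p \<ge> 7\<close>; hence \<open>G j\<close> has
  coefficient \<open>w j (j + 1)\<close>. Summing over \<open>j\<close> yields the coefficient \<open>w N R (N - R)\<close>. The passages
  from \<open>p\<close> to \<open>p\<^sup>2\<close> and from \<open>p\<^sup>2\<close> to \<open>p\<^sup>3\<close> only contribute multiples of \<open>p\<^sup>3\<close> to the coefficient, and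
  each offset \<open>m\<close> of a multiple of \<open>p\<^sup>3\<close> contributes a unit \<open>(X p\<^sup>3 + m choose m)\<close> with
  coefficient \<open>X H\<^sub>1(m)\<close>.
\<close>

section \<open>Power sums and binomial identities\<close>

lemma residue_primroot_prime_bij_betw:
  assumes "prime p" "residue_primroot p g"
  shows "bij_betw (\<lambda>i. g ^ i mod p) {..<p-1} {1..p-1}"
proof -
  have "totatives p = {1..p-1}" unfolding totatives_prime[OF assms(1)] by auto
  then show ?thesis
    using residue_primroot_is_generator[OF prime_gt_1_nat[OF assms(1)] assms(2)]
    by (simp add: totient_prime assms(1))
qed

lemma sum_powers_cong_0:
  fixes p m :: nat
  assumes "prime p" "\<not> (p - 1) dvd m"
  shows "[(\<Sum>k=1..p-1. k ^ m) = 0] (mod p)"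
proof -
  obtain g where g: "residue_primroot p g"
    using prime_primitive_root_exists[OF prime_gt_1_nat[OF assms(1)] assms(1)] by blast
  have "(\<Sum>k=1..p-1. k ^ m) = (\<Sum>i<p-1. (g ^ i mod p) ^ m)"
    by (rule sum.reindex_bij_betw[OF residue_primroot_prime_bij_betw[OF assms(1) g], symmetric])
  also have "[\<dots> = (\<Sum>i<p-1. (g ^ m) ^ i)] (mod p)"
  proof (rule cong_sum)
    fix i
    have "[(g ^ i mod p) ^ m = (g ^ i) ^ m] (mod p)" by (intro cong_pow) simp
    then show "[(g ^ i mod p) ^ m = (g ^ m) ^ i] (mod p)"
      by (simp only: power_mult[symmetric] mult.commute)
  qed
  finally have geometric: "[(\<Sum>k=1..p-1. k ^ m) = (\<Sum>i<p-1. (g ^ m) ^ i)] (mod p)" .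
  have "coprime g p"
    using g by (simp add: residue_primroot_def coprime_commute)
  then have "\<not> p dvd g ^ m"
    by (metis assms(1) coprime_absorb_right not_prime_unit prime_dvd_power)
  then have "[(g ^ m) ^ (p - 1) = 1] (mod p)" by (rule fermat_theorem[OF assms(1)])
  then have "[int (g ^ m) ^ (p - 1) = 1] (mod int p)" by (simp flip: cong_int_iff)
  then have "int p dvd int (g ^ m) ^ (p - 1) - 1" by (simp only: cong_iff_dvd_diff)
  then have "int p dvd (int (g ^ m) - 1) * (\<Sum>i<p-1. int (g ^ m) ^ i)"
    by (simp only: power_diff_1_eq)
  moreover have "\<not> int p dvd int (g ^ m) - 1"
  proof -
    have "\<not> [g ^ m = 1] (mod p)"
      using g assms by (simp add: ord_divides' residue_primroot_def totient_prime)
    then have "\<not> [int (g ^ m) = 1] (mod int p)" by (simp flip: cong_int_iff)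
    then show ?thesis by (simp only: cong_iff_dvd_diff not_False_eq_True)
  qed
  ultimately have "int p dvd (\<Sum>i<p-1. int (g ^ m) ^ i)"
    using assms(1) by (simp add: prime_dvd_mult_iff)
  then have "p dvd (\<Sum>i<p-1. (g ^ m) ^ i)" by (simp flip: of_nat_power of_nat_sum)
  then show ?thesis using geometric cong_trans cong_0_iff by blast
qed

lemma gbinomial_add_of_nat_eq_prod:
  fixes x :: "'a::field_char_0"
  shows "(x + of_nat n) gchoose n = (\<Prod>k=1..n. 1 + x / of_nat k)"
proof -
  have "pochhammer (x + 1) n = fact n * (\<Prod>k=1..n. 1 + x / of_nat k)"
    by (induction n)
      (simp_all add: pochhammer_Suc field_simps del: of_nat_Suc, simp add: algebra_simps)
  then show ?thesis by (simp add: gbinomial_pochhammer')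
qed

lemma fact_add_eq_binomial: "fact (m + n) = fact m * fact n * (m + n choose m)" for m n :: nat
  using binomial_fact_lemma[of m "m + n"] by simp

lemma binomial_add_add_le:
  assumes "b \<le> a" "r \<le> n"
  shows "(a + n choose (b + r)) * (b + r choose r) * (a - b + (n - r) choose (n - r)) =
    (a choose b) * (n choose r) * (a + n choose n)"
proof -
  obtain d e where a_eq: "a = b + d" and n_eq: "n = r + e" using assms le_iff_add by metis
  define c where "c = fact b * fact d * fact r * (fact e :: nat)"
  have "c * ((a + n choose (b + r)) * (r + b choose r) * (e + d choose e)) =
      fact (r + b) * fact (e + d) * (a + n choose (b + r))"
    unfolding c_def fact_add_eq_binomial by (simp only: mult_ac)
  also have "\<dots> = fact (a + n)"
    using fact_add_eq_binomial[of "b + r" "e + d"] by (simp add: a_eq n_eq add_ac)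
  also have "\<dots> = fact (b + d) * fact (r + e) * (a + n choose n)"
    using fact_add_eq_binomial[of n a] by (simp add: a_eq n_eq mult_ac add_ac)
  also have "\<dots> = c * ((a choose b) * (n choose r) * (a + n choose n))"
    unfolding a_eq n_eq c_def fact_add_eq_binomial by (simp only: mult_ac)
  finally show ?thesis by (simp add: c_def a_eq n_eq add_ac)
qed

lemma binomial_add_add_gt:
  assumes "b \<le> a" "n < r"
  shows "(a + n choose (b + r)) * (b + r choose r) * r * (r - 1 choose n) =
    (a choose b) * (a - b) * (a - b - 1 choose (r - n - 1)) * (a + n choose n)"
proof (cases "b + r \<le> a + n")
  case True
  obtain j where r_eq: "r = Suc (n + j)" using assms(2) less_iff_Suc_add by blast
  then have "b + Suc j \<le> a" using True by simp
  then obtain i where a_eq: "a = b + Suc (j + i)" by (auto simp: le_iff_add add_ac)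
  define c where "c = fact b * fact n * fact j * (fact i :: nat)"
  have "c * ((a + n choose (b + r)) * (r + b choose r) * r * (n + j choose n)) =
      fact (r + b) * fact i * (a + n choose (b + r))"
    unfolding c_def r_eq fact_add_eq_binomial fact_Suc of_nat_id by (simp only: mult_ac)
  also have "\<dots> = fact (a + n)"
    using fact_add_eq_binomial[of "b + r" i] by (simp add: a_eq r_eq add_ac)
  also have "\<dots> = fact (b + Suc (j + i)) * fact n * (a + n choose n)"
    using fact_add_eq_binomial[of n a] by (simp add: a_eq mult_ac add_ac)
  also have "\<dots> = c * ((a choose b) * (a - b) * (j + i choose j) * (a + n choose n))"
    unfolding a_eq c_def fact_add_eq_binomial fact_Suc of_nat_id by (simp add: algebra_simps)
  finally show ?thesis by (simp add: c_def a_eq r_eq add_ac)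
next
  case False
  then have "a = b \<or> a - b - 1 < r - n - 1" using assms by linarith
  then show ?thesis using False by (auto simp: binomial_eq_0)
qed

text \<open>The factor \<open>m\<close> on both sides absorbs the truncated subtraction at \<open>m = 0\<close>.\<close>

lemma of_nat_mult_binomial_pred:
  fixes m d :: nat
  shows "(of_nat m * of_nat (m - 1 choose d) :: 'a::field_char_0) =
    (- 1) ^ d * of_nat m * ((of_nat d - of_nat m) gchoose d)"
proof (cases m)
  case (Suc l)
  have "of_nat (m - 1 choose d) = (- 1) ^ d * ((of_nat d - of_nat (m - 1) - 1) gchoose d :: 'a)"
    unfolding binomial_gbinomial by (rule gbinomial_negated_upper)
  also have "of_nat d - of_nat (m - 1) - 1 = (of_nat d - of_nat m :: 'a)" by (simp add: Suc)
  finally show ?thesis by simp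
qed simp

lemma binomial_add_add_gt_quotient:
  assumes "b \<le> a" "n < r"
  shows "(of_nat (a + n choose (b + r)) / of_nat (a choose b) :: 'a::field_char_0) =
    (- 1) ^ (r - n - 1) * (of_nat (a - b) / of_nat r) * inverse (of_nat (r - 1 choose n)) *
    (of_nat (a + n choose n) * ((of_nat (r - n - 1) - of_nat (a - b)) gchoose (r - n - 1))
      / of_nat (b + r choose r))"
proof -
  define d where "d = r - n - 1"
  have "(of_nat (a + n choose (b + r)) * of_nat (b + r choose r) * of_nat r
        * of_nat (r - 1 choose n) :: 'a) =
      of_nat (a choose b) * (of_nat (a - b) * of_nat (a - b - 1 choose d)) * of_nat (a + n choose n)"
    using arg_cong[OF binomial_add_add_gt[OF assms], of "of_nat :: nat \<Rightarrow> 'a"]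
    by (simp add: d_def mult.assoc del: of_nat_diff)
  also have "of_nat (a - b) * of_nat (a - b - 1 choose d) =
      (- 1) ^ d * of_nat (a - b) * ((of_nat d - of_nat (a - b)) gchoose d :: 'a)"
    by (rule of_nat_mult_binomial_pred)
  finally show ?thesis
    unfolding d_def[symmetric] using assms by (simp add: field_simps del: of_nat_diff)
qed

definition block_prod :: "nat \<Rightarrow> nat \<Rightarrow> nat" where
  "block_prod p N = (\<Prod>j<N. j * p + (p - 1) choose (p - 1))"

lemma fact_mult_eq_block_prod:
  assumes "p > 0"
  shows "(fact (N * p) :: nat) = p ^ N * fact N * fact (p - 1) ^ N * block_prod p N"
proof (induction N)
  case (Suc N)
  have "Suc N * p = Suc (N * p + (p - 1))" using assms by simp
  then have "(fact (Suc N * p) :: nat) = Suc N * p * fact (N * p + (p - 1))"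
    by (metis fact_Suc of_nat_id)
  also have "fact (N * p + (p - 1)) =
      fact (N * p) * fact (p - 1) * (N * p + (p - 1) choose (p - 1))"
    using fact_add_eq_binomial[of "p - 1" "N * p"] by (simp only: mult_ac add_ac)
  finally show ?case unfolding Suc.IH by (simp add: block_prod_def algebra_simps)
qed (simp add: block_prod_def)

lemma binomial_mult_mult_eq_block_prod:
  assumes "p > 0" "R \<le> N"
  shows "(N * p choose (R * p)) * (block_prod p R * block_prod p (N - R)) =
    (N choose R) * block_prod p N"
proof -
  obtain D where N_eq: "N = R + D" using assms(2) le_iff_add by blast
  define c where "c = p ^ R * p ^ D * fact R * fact D * fact (p - 1) ^ R * fact (p - 1) ^ D"
  have "c * ((N * p choose (R * p)) * (block_prod p R * block_prod p D)) =
      fact (R * p) * fact (D * p) * (N * p choose (R * p))"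
    unfolding fact_mult_eq_block_prod[OF assms(1)] c_def by (simp only: mult_ac)
  also have "\<dots> = fact (N * p)"
    using fact_add_eq_binomial[of "R * p" "D * p"] by (simp add: N_eq distrib_right)
  also have "\<dots> = c * ((N choose R) * block_prod p N)"
    unfolding fact_mult_eq_block_prod[OF assms(1)] N_eq fact_add_eq_binomial[of R D] power_add c_def
    by (simp only: mult_ac)
  finally show ?thesis using assms(1) by (simp add: c_def N_eq)
qed

lemma sum_inverse_mult_reflect:
  "of_nat p * (\<Sum>k=1..p-1. 1 / (of_nat k * of_nat (p - k))) = 2 * H1 (p - 1)"
proof -
  have "of_nat p * (1 / (of_nat k * of_nat (p - k))) = 1 / of_nat k + 1 / (of_nat (p - k) :: rat)"
    if "k \<in> {1..p-1}" for k
    using that by (auto simp: field_simps of_nat_diff)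
  then have "of_nat p * (\<Sum>k=1..p-1. 1 / (of_nat k * of_nat (p - k))) =
      (\<Sum>k=1..p-1. 1 / of_nat k + 1 / (of_nat (p - k) :: rat))"
    unfolding sum_distrib_left by (rule sum.cong[OF refl])
  moreover have "(\<Sum>k=1..p-1. 1 / (of_nat (p - k) :: rat)) = (\<Sum>k=1..p-1. 1 / of_nat k)"
    by (rule sum.reindex_bij_witness[of _ "\<lambda>k. p - k" "\<lambda>k. p - k"]) auto
  ultimately show ?thesis by (simp add: sum.distrib H1_def)
qed

lemma gbinomial_mult_pred_square:
  fixes x :: "'a::field_char_0"
  assumes "p > 0"
  shows "((x * of_nat p + of_nat (p - 1)) gchoose (p - 1))\<^sup>2 =
    (\<Prod>k=1..p-1. 1 + x * (x + 1) / (of_nat k * of_nat (p - k)) * of_nat p ^ 2)"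
proof -
  have "(\<Prod>k=1..p-1. 1 + x * of_nat p / of_nat k) = (\<Prod>k=1..p-1. 1 + x * of_nat p / of_nat (p - k))"
    by (rule prod.reindex_bij_witness[of _ "\<lambda>k. p - k" "\<lambda>k. p - k"]) auto
  then have "((x * of_nat p + of_nat (p - 1)) gchoose (p - 1))\<^sup>2 =
      (\<Prod>k=1..p-1. (1 + x * of_nat p / of_nat k) * (1 + x * of_nat p / of_nat (p - k)))"
    unfolding gbinomial_add_of_nat_eq_prod power2_eq_square prod.distrib by simp
  also have "\<dots> = (\<Prod>k=1..p-1. 1 + x * (x + 1) / (of_nat k * of_nat (p - k)) * of_nat p ^ 2)"
    by (rule prod.cong) (auto simp: field_simps of_nat_diff power2_eq_square)
  finally show ?thesis .
qed

section \<open>Congruences between p-integral rationals\<close>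

lemma p_integral_iff_quotient:
  "p_integral p x \<longleftrightarrow> (\<exists>a b. \<not> int p dvd b \<and> x = of_int a / of_int b)"
proof
  assume "p_integral p x"
  moreover have "x = of_int (fst (quotient_of x)) / of_int (snd (quotient_of x))"
    by (simp add: quotient_of_div)
  ultimately show "\<exists>a b. \<not> int p dvd b \<and> x = of_int a / of_int b"
    unfolding p_integral_def by blast
next
  assume "\<exists>a b. \<not> int p dvd b \<and> x = of_int a / of_int b"
  then obtain a b where b_not_dvd: "\<not> int p dvd b" and x_eq: "x = of_int a / of_int b" by blast
  obtain c d where quotient: "quotient_of x = (c, d)" by (cases "quotient_of x")
  have lowest_terms: "d > 0" "coprime c d" "x = of_int c / of_int d"
    using quotient quotient_of_denom_pos quotient_of_coprime quotient_of_div by auto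
  have "b \<noteq> 0" using b_not_dvd by auto
  then have "(of_int (a * d) :: rat) = of_int (c * b)"
    using x_eq lowest_terms by (simp add: field_simps)
  then have "a * d = c * b" by (simp only: of_int_eq_iff)
  then have "d dvd c * b" by (metis dvd_triv_right)
  then have "d dvd b"
    using lowest_terms(2) by (simp add: coprime_commute coprime_dvd_mult_right_iff)
  then show "p_integral p x"
    using b_not_dvd quotient unfolding p_integral_def by (auto dest: dvd_trans)
qed

text \<open>For \<open>l \<le> 2 * k\<close> the coefficient \<open>a\<close> behaves like a logarithm: products of \<open>u\<close> become sums of \<open>a\<close>.\<close>

definition first_order_pcong :: "nat \<Rightarrow> nat \<Rightarrow> nat \<Rightarrow> rat \<Rightarrow> rat \<Rightarrow> bool" where
  "first_order_pcong p k l u a \<longleftrightarrow> p_integral p a \<and> pcong p l u (1 + a * of_nat p ^ k)"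

definition jacobsthal_coeff :: "nat \<Rightarrow> nat \<Rightarrow> nat \<Rightarrow> rat" where
  "jacobsthal_coeff p N R = of_int (wolst p) * of_nat N * of_nat R * (of_nat N - of_nat R)"

context
  fixes p :: nat
  assumes prime_p: "prime p"
begin

lemma p_integral_of_int [simp]: "p_integral p (of_int a)"
  unfolding p_integral_iff_quotient using prime_gt_1_nat[OF prime_p]
  by (intro exI[of _ a] exI[of _ 1]) auto

lemma p_integral_of_nat [simp]: "p_integral p (of_nat a)"
  using p_integral_of_int[of "int a"] by simp

lemma p_integral_numeral [simp]: "p_integral p (numeral n)"
  using p_integral_of_nat[of "numeral n"] by simp

lemma p_integral_0 [simp]: "p_integral p 0"
  using p_integral_of_nat[of 0] by simp

lemma p_integral_1 [simp]: "p_integral p 1"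
  using p_integral_of_nat[of 1] by simp

lemma p_integral_add:
  assumes "p_integral p x" "p_integral p y"
  shows "p_integral p (x + y)"
proof -
  obtain a b c d where x_eq: "\<not> int p dvd b" "x = of_int a / of_int b"
    and y_eq: "\<not> int p dvd d" "y = of_int c / of_int d"
    using assms unfolding p_integral_iff_quotient by blast
  have "b \<noteq> 0" "d \<noteq> 0" using x_eq y_eq by auto
  then have "x + y = of_int (a * d + c * b) / of_int (b * d)" by (simp add: x_eq y_eq add_frac_eq)
  moreover have "\<not> int p dvd b * d" using x_eq y_eq prime_p by (simp add: prime_dvd_mult_iff)
  ultimately show ?thesis unfolding p_integral_iff_quotient by blast
qed

lemma p_integral_mult:
  assumes "p_integral p x" "p_integral p y"
  shows "p_integral p (x * y)"
proof -
  obtain a b c d where x_eq: "\<not> int p dvd b" "x = of_int a / of_int b"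
    and y_eq: "\<not> int p dvd d" "y = of_int c / of_int d"
    using assms unfolding p_integral_iff_quotient by blast
  have "x * y = of_int (a * c) / of_int (b * d)" by (simp add: x_eq y_eq)
  moreover have "\<not> int p dvd b * d" using x_eq y_eq prime_p by (simp add: prime_dvd_mult_iff)
  ultimately show ?thesis unfolding p_integral_iff_quotient by blast
qed

lemma p_integral_minus: "p_integral p x \<Longrightarrow> p_integral p (- x)"
  using p_integral_mult[of "of_int (- 1)" x] p_integral_of_int[of "- 1"] by simp

lemma p_integral_diff: "p_integral p x \<Longrightarrow> p_integral p y \<Longrightarrow> p_integral p (x - y)"
  using p_integral_add[of x "- y"] p_integral_minus by simp

lemma p_integral_power: "p_integral p x \<Longrightarrow> p_integral p (x ^ n)"
  by (induction n) (auto intro: p_integral_mult)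

lemma p_integral_sum: "(\<And>i. i \<in> A \<Longrightarrow> p_integral p (f i)) \<Longrightarrow> p_integral p (sum f A)"
  by (induction A rule: infinite_finite_induct) (auto intro: p_integral_add)

lemma p_integral_divide_of_nat:
  assumes "p_integral p x" "\<not> p dvd k"
  shows "p_integral p (x / of_nat k)"
proof -
  have "p_integral p (1 / of_nat k)"
    unfolding p_integral_iff_quotient using assms(2) by (intro exI[of _ 1] exI[of _ "int k"]) simp
  then show ?thesis using p_integral_mult[OF assms(1)] by fastforce
qed

lemma p_integral_divide_of_nat_less:
  assumes "p_integral p x" "0 < k" "k < p"
  shows "p_integral p (x / of_nat k)"
  using assms nat_dvd_not_less by (blast intro: p_integral_divide_of_nat)

lemma p_integral_divide_2: "p_integral p x \<Longrightarrow> 2 < p \<Longrightarrow> p_integral p (x / 2)"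
  using p_integral_divide_of_nat_less[of x 2] by simp

lemmas p_integral_intros = p_integral_add p_integral_mult p_integral_minus p_integral_diff
  p_integral_power p_integral_sum

lemma pcongI:
  assumes "p_integral p y" "p_integral p z" "x = y + of_nat p ^ k * z"
  shows "pcong p k x y"
  using assms unfolding pcong_def by (auto intro!: p_integral_intros)

lemma pcongE:
  assumes "pcong p k x y"
  obtains z where "p_integral p x" "p_integral p y" "p_integral p z" "x = y + of_nat p ^ k * z"
  using assms unfolding pcong_def by (auto simp: algebra_simps)

lemma pcong_imp_p_integral:
  assumes "pcong p k x y"
  shows "p_integral p x" "p_integral p y"
  using assms unfolding pcong_def by auto

lemma pcong_refl: "p_integral p x \<Longrightarrow> pcong p k x x"
  by (rule pcongI[of _ 0]) auto

lemma pcong_sym: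
  assumes "pcong p k x y"
  shows "pcong p k y x"
  using assms
proof (rule pcongE)
  fix z assume "p_integral p x" "p_integral p z" "x = y + of_nat p ^ k * z"
  then show ?thesis by (intro pcongI[of _ "- z"]) (auto intro: p_integral_minus)
qed

lemma pcong_add:
  assumes "pcong p k x y" "pcong p k x' y'"
  shows "pcong p k (x + x') (y + y')"
proof -
  obtain u v where "p_integral p y" "p_integral p y'" "p_integral p u" "p_integral p v"
    "x = y + of_nat p ^ k * u" "x' = y' + of_nat p ^ k * v" using assms by (elim pcongE)
  then show ?thesis
    by (intro pcongI[of _ "u + v"]) (auto intro: p_integral_intros simp: algebra_simps)
qed

lemma pcong_trans [trans]:
  assumes "pcong p k x y" "pcong p k y z"
  shows "pcong p k x z"
proof -
  obtain u v where "p_integral p z" "p_integral p u" "p_integral p v"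
    "x = y + of_nat p ^ k * u" "y = z + of_nat p ^ k * v" using assms by (elim pcongE)
  then show ?thesis
    by (intro pcongI[of _ "u + v"]) (auto intro: p_integral_intros simp: algebra_simps)
qed

lemma pcong_mult:
  assumes "pcong p k x y" "pcong p k x' y'"
  shows "pcong p k (x * x') (y * y')"
proof -
  obtain u v where "p_integral p y" "p_integral p x'" "p_integral p y'"
    "p_integral p u" "p_integral p v"
    "x = y + of_nat p ^ k * u" "x' = y' + of_nat p ^ k * v" using assms by (elim pcongE)
  then show ?thesis
    by (intro pcongI[of _ "u * x' + y * v"] p_integral_intros) (simp_all add: algebra_simps)
qed

lemma pcong_mult_left: "pcong p k x y \<Longrightarrow> p_integral p c \<Longrightarrow> pcong p k (c * x) (c * y)"
  by (intro pcong_mult pcong_refl)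

lemma pcong_sum: "(\<And>i. i \<in> A \<Longrightarrow> pcong p k (f i) (g i)) \<Longrightarrow> pcong p k (sum f A) (sum g A)"
  by (induction A rule: infinite_finite_induct) (auto intro: pcong_refl pcong_add)

lemma pcong_power: "pcong p k x y \<Longrightarrow> pcong p k (x ^ n) (y ^ n)"
  by (induction n) (auto intro: pcong_refl pcong_mult)

lemma pcong_power_le:
  assumes "pcong p k x y" "l \<le> k"
  shows "pcong p l x y"
proof -
  obtain z where x_eq: "p_integral p y" "p_integral p z" "x = y + of_nat p ^ k * z"
    using assms(1) by (elim pcongE)
  have "(of_nat p :: rat) ^ k = of_nat p ^ l * of_nat p ^ (k - l)"
    using assms(2) by (simp flip: power_add)
  then show ?thesis using x_eq
    by (intro pcongI[of _ "of_nat p ^ (k - l) * z"] p_integral_intros) simp_all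
qed

lemma pcong_mult_power:
  assumes "pcong p k x y"
  shows "pcong p (k + l) (x * of_nat p ^ l) (y * of_nat p ^ l)"
  using assms
proof (rule pcongE)
  fix z assume "p_integral p y" "p_integral p z" "x = y + of_nat p ^ k * z"
  then show ?thesis
    by (intro pcongI[of _ z] p_integral_intros) (simp_all add: algebra_simps power_add)
qed

lemma pcong_power_0:
  assumes "p_integral p x" "k \<le> l"
  shows "pcong p k (x * of_nat p ^ l) 0"
proof -
  have "pcong p 0 x 0" using assms(1) by (intro pcongI[of _ x]) auto
  from pcong_mult_power[OF this, of l] show ?thesis using assms(2) by (auto intro: pcong_power_le)
qed

lemma pcong_diff_0_iff:
  assumes "p_integral p x" "p_integral p y"
  shows "pcong p k (x - y) 0 \<longleftrightarrow> pcong p k x y"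
  using assms unfolding pcong_def by (auto intro: p_integral_diff)

lemma pcong_of_int_iff: "pcong p k (of_int a) (of_int b) \<longleftrightarrow> [a = b] (mod int p ^ k)"
proof
  assume "pcong p k (of_int a) (of_int b)"
  then obtain c d where d_not_dvd: "\<not> int p dvd d"
    and "(of_int a - of_int b :: rat) = of_nat p ^ k * (of_int c / of_int d)"
    unfolding pcong_def p_integral_iff_quotient by blast
  then have "(of_int ((a - b) * d) :: rat) = of_int (int p ^ k * c)"
    by (auto simp: field_simps)
  then have "(a - b) * d = int p ^ k * c" by (simp only: of_int_eq_iff)
  then have "int p ^ k dvd (a - b) * d" by simp
  moreover have "coprime (int p ^ k) d"
    using prime_imp_coprime[OF _ d_not_dvd] prime_p by simp
  ultimately show "[a = b] (mod int p ^ k)"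
    by (simp add: cong_iff_dvd_diff coprime_dvd_mult_left_iff)
next
  assume "[a = b] (mod int p ^ k)"
  then obtain q where "a - b = int p ^ k * q" unfolding cong_iff_dvd_diff by (rule dvdE)
  then have "a = b + int p ^ k * q" by simp
  then show "pcong p k (of_int a) (of_int b)" by (intro pcongI[of _ "of_int q"]) simp_all
qed

lemma pcong_of_nat_iff: "pcong p k (of_nat a) (of_nat b) \<longleftrightarrow> [a = b] (mod p ^ k)"
  using pcong_of_int_iff[of k "int a" "int b"] by (simp flip: of_nat_power add: cong_int_iff)

lemma of_nat_pcong_0_iff: "pcong p 1 (of_nat a) 0 \<longleftrightarrow> p dvd a"
  using pcong_of_nat_iff[of 1 a 0] by (simp add: cong_0_iff)

lemma p_integral_inverse:
  assumes "p_integral p x" "\<not> pcong p 1 x 0"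
  shows "p_integral p (inverse x)"
proof -
  obtain a b where b_not_dvd: "\<not> int p dvd b" and x_eq: "x = of_int a / of_int b"
    using assms(1) unfolding p_integral_iff_quotient by blast
  have "\<not> int p dvd a"
  proof
    assume "int p dvd a"
    then obtain c where "a = int p * c" by (rule dvdE)
    moreover have "p_integral p (of_int c / of_int b)"
      using b_not_dvd unfolding p_integral_iff_quotient by blast
    ultimately have "pcong p 1 x 0"
      by (intro pcongI[of _ "of_int c / of_int b"]) (simp_all add: x_eq)
    then show False using assms(2) by contradiction
  qed
  then show ?thesis
    unfolding p_integral_iff_quotient by (intro exI[of _ b] exI[of _ a]) (simp add: x_eq)
qed

lemma pcong_mult_left_cancel:
  assumes "p_integral p u" "\<not> pcong p 1 u 0" "p_integral p x" "p_integral p y"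
  shows "pcong p k (u * x) (u * y) \<longleftrightarrow> pcong p k x y"
proof
  have "u \<noteq> 0" using assms(2) pcong_refl[OF p_integral_0] by auto
  moreover assume "pcong p k (u * x) (u * y)"
  then have "pcong p k (inverse u * (u * x)) (inverse u * (u * y))"
    by (rule pcong_mult_left) (rule p_integral_inverse[OF assms(1,2)])
  ultimately show "pcong p k x y" by (simp flip: mult.assoc)
qed (rule pcong_mult_left[OF _ assms(1)])

lemma ex1_int_pcong:
  assumes "p_integral p x"
  shows "\<exists>!w. 0 \<le> w \<and> w < int p ^ k \<and> pcong p k (of_int w) x"
proof -
  obtain a b where b_not_dvd: "\<not> int p dvd b" and x_eq: "x = of_int a / of_int b"
    using assms unfolding p_integral_iff_quotient by blast
  have "coprime b (int p ^ k)"
    using prime_imp_coprime[OF _ b_not_dvd] prime_p by (simp add: coprime_commute)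
  then obtain c where "[b * c = 1] (mod int p ^ k)" using cong_solve_coprime_int by blast
  then have "pcong p k (of_int (b * c)) (of_int 1)" by (simp only: pcong_of_int_iff)
  from pcong_mult_left[OF this assms] have pcong_ac: "pcong p k (of_int (a * c)) x"
    using b_not_dvd by (cases "b = 0") (simp_all add: x_eq)
  define w where "w = a * c mod int p ^ k"
  have modulus_pos: "int p ^ k > 0" using prime_gt_0_nat[OF prime_p] by simp
  show ?thesis
  proof (rule ex1I[of _ w])
    have "pcong p k (of_int w) (of_int (a * c))"
      by (simp only: pcong_of_int_iff w_def cong_mod_left cong_refl)
    then show "0 \<le> w \<and> w < int p ^ k \<and> pcong p k (of_int w) x"
      using modulus_pos pcong_ac pcong_trans by (auto simp: w_def)
  next
    fix v assume v: "0 \<le> v \<and> v < int p ^ k \<and> pcong p k (of_int v) x"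
    then have "[v = a * c] (mod int p ^ k)"
      using pcong_ac pcong_sym pcong_trans pcong_of_int_iff by blast
    then show "v = w" using v by (simp add: cong_def w_def)
  qed
qed

section \<open>Harmonic sums\<close>

lemma inverse_power_pcong_power:
  assumes "0 < k" "k < p"
  shows "pcong p 1 (1 / of_nat k ^ s) (of_nat (k ^ ((p - 2) * s)))"
proof -
  have not_dvd: "\<not> p dvd k" using assms nat_dvd_not_less by blast
  have "[(k ^ (p - 1)) ^ s = 1 ^ s] (mod p)"
    by (rule cong_pow[OF fermat_theorem[OF prime_p not_dvd]])
  moreover have "p - 1 = Suc (p - 2)" using prime_ge_2_nat[OF prime_p] by simp
  ultimately have "[k ^ s * k ^ ((p - 2) * s) = 1] (mod p ^ 1)"
    by (simp add: power_add flip: power_mult)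
  then have "pcong p 1 (of_nat (k ^ s * k ^ ((p - 2) * s))) (of_nat 1)"
    by (simp only: pcong_of_nat_iff)
  then have "pcong p 1 (of_nat (k ^ s) * of_nat (k ^ ((p - 2) * s)))
      (of_nat (k ^ s) * (1 / of_nat k ^ s))"
    using assms(1) by simp
  moreover have "\<not> pcong p 1 (of_nat (k ^ s)) 0"
    using not_dvd prime_dvd_power[OF prime_p] by (simp only: of_nat_pcong_0_iff) blast
  moreover have "p_integral p (1 / of_nat k ^ s)"
    using p_integral_power[OF p_integral_divide_of_nat[OF p_integral_1 not_dvd], of s]
    by (simp add: power_one_over)
  ultimately show ?thesis
    using pcong_mult_left_cancel pcong_sym p_integral_of_nat by blast
qed

lemma sum_inverse_powers_pcong_0:
  assumes "\<not> (p - 1) dvd s"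
  shows "pcong p 1 (\<Sum>k=1..p-1. 1 / of_nat k ^ s) 0"
proof -
  have "p - 1 = Suc (p - 2)" using prime_ge_2_nat[OF prime_p] by simp
  then have "(p - 1) * s = (p - 2) * s + s" by simp
  then have "\<not> (p - 1) dvd (p - 2) * s"
    using assms by (metis dvd_add_right_iff dvd_triv_left)
  then have "pcong p 1 (of_nat (\<Sum>k=1..p-1. k ^ ((p - 2) * s))) 0"
    using sum_powers_cong_0[OF prime_p] by (simp only: of_nat_pcong_0_iff cong_0_iff)
  moreover have "pcong p 1 (\<Sum>k=1..p-1. 1 / of_nat k ^ s) (\<Sum>k=1..p-1. of_nat (k ^ ((p - 2) * s)))"
    by (intro pcong_sum inverse_power_pcong_power) auto
  ultimately show ?thesis using pcong_trans by simp
qed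

lemma inverse_mult_reflect_pcong:
  assumes "0 < k" "k < p"
  shows "pcong p 1 (1 / (of_nat k * of_nat (p - k))) (- (1 / of_nat k ^ 2))"
proof (rule pcongI)
  have "p_integral p (1 / of_nat k)" "p_integral p (1 / of_nat (p - k))"
    using assms by (intro p_integral_divide_of_nat_less p_integral_1; simp)+
  then have "p_integral p (- ((1 / of_nat k) ^ 2))"
    and "p_integral p ((1 / of_nat k) ^ 2 * (1 / of_nat (p - k)))"
    by (blast intro: p_integral_intros)+
  then show "p_integral p (- (1 / of_nat k ^ 2))"
    and "p_integral p (1 / (of_nat k ^ 2 * of_nat (p - k)))"
    by (simp_all add: power_one_over)
  show "1 / (of_nat k * of_nat (p - k)) =
      - (1 / of_nat k ^ 2) + of_nat p ^ 1 * (1 / (of_nat k ^ 2 * of_nat (p - k)) :: rat)"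
    using assms by (simp add: field_simps of_nat_diff power2_eq_square)
qed

lemma sum_inverse_mult_reflect_power_pcong_0:
  assumes "\<not> (p - 1) dvd 2 * s"
  shows "pcong p 1 (\<Sum>k=1..p-1. (1 / (of_nat k * of_nat (p - k))) ^ s) 0"
proof -
  have "pcong p 1 (\<Sum>k=1..p-1. (1 / (of_nat k * of_nat (p - k))) ^ s)
      (\<Sum>k=1..p-1. (- (1 / of_nat k ^ 2)) ^ s)"
    by (intro pcong_sum pcong_power inverse_mult_reflect_pcong) auto
  also have "(\<Sum>k=1..p-1. (- (1 / of_nat k ^ 2)) ^ s) =
      (- 1) ^ s * (\<Sum>k=1..p-1. 1 / of_nat k ^ (2 * s) :: rat)"
    by (simp only: power_minus[of "1 / _"] power_one_over power_mult sum_distrib_left)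
  also have "pcong p 1 \<dots> ((- 1) ^ s * 0)"
    by (intro pcong_mult_left sum_inverse_powers_pcong_0 assms p_integral_power p_integral_minus
        p_integral_1)
  finally show ?thesis by simp
qed

lemma wolstenholme_harmonic:
  assumes "p \<ge> 5"
  shows "p_integral p (H1 (p - 1) / of_nat p ^ 2)"
proof -
  have "\<not> (p - 1) dvd 2 * 1" using assms by (auto dest: dvd_imp_le)
  then have "pcong p 1 (\<Sum>k=1..p-1. 1 / (of_nat k * of_nat (p - k))) 0"
    using sum_inverse_mult_reflect_power_pcong_0[of 1] by simp
  then obtain z where z_integral: "p_integral p z"
    and sum: "(\<Sum>k=1..p-1. 1 / (of_nat k * of_nat (p - k))) = of_nat p * z"
    by (elim pcongE) auto
  have quotient: "H1 (p - 1) / of_nat p ^ 2 = z / 2"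
    using sum_inverse_mult_reflect[of p] prime_gt_0_nat[OF prime_p]
    unfolding sum by (simp add: field_simps power2_eq_square)
  show ?thesis unfolding quotient using z_integral assms by (intro p_integral_divide_2) simp_all
qed

lemma wolst_pcong:
  assumes "p \<ge> 5"
  shows "pcong p 2 (of_int (wolst p)) (H1 (p - 1) / of_nat p ^ 2)"
  using theI'[OF ex1_int_pcong[OF wolstenholme_harmonic[OF assms], of 2]] unfolding wolst_def
  by blast

section \<open>First-order congruences\<close>

lemma prod_one_plus_pcong:
  assumes "2 < p" "\<And>i. i \<in> A \<Longrightarrow> p_integral p (t i)"
  shows "pcong p (3 * m) (\<Prod>i\<in>A. 1 + t i * of_nat p ^ m)
    (1 + sum t A * of_nat p ^ m + ((sum t A)\<^sup>2 - (\<Sum>i\<in>A. (t i)\<^sup>2)) / 2 * of_nat p ^ (2 * m))"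
  using assms(2)
proof (induction A rule: infinite_finite_induct)
  case (insert i A)
  define s where "s = sum t A"
  define e where "e = (s\<^sup>2 - (\<Sum>i\<in>A. (t i)\<^sup>2)) / 2"
  have s_integral: "p_integral p s"
    using insert.prems unfolding s_def by (intro p_integral_sum) auto
  have e_integral: "p_integral p e"
    unfolding e_def using insert.prems assms(1) s_integral
    by (intro p_integral_divide_2 p_integral_diff p_integral_sum p_integral_power) auto
  have t_integral: "p_integral p (t i)" using insert.prems by simp
  have "pcong p (3 * m) (\<Prod>i\<in>insert i A. 1 + t i * of_nat p ^ m)
      ((1 + t i * of_nat p ^ m) * (1 + s * of_nat p ^ m + e * of_nat p ^ (2 * m)))"
    using insert.hyps insert.IH insert.prems t_integral unfolding s_def e_def
    by (auto intro!: pcong_mult_left p_integral_intros)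
  also have "pcong p (3 * m) \<dots> (1 + (t i + s) * of_nat p ^ m + (e + t i * s) * of_nat p ^ (2 * m))"
    using s_integral e_integral t_integral
    by (intro pcongI[of _ "t i * e"] p_integral_intros)
      (simp_all add: algebra_simps power_mult power2_eq_square power3_eq_cube mult.commute[of _ m])
  also have "e + t i * s = ((sum t (insert i A))\<^sup>2 - (\<Sum>i\<in>insert i A. (t i)\<^sup>2)) / 2"
    using insert.hyps unfolding e_def s_def by (simp add: field_simps power2_eq_square)
  also have "t i + s = sum t (insert i A)" using insert.hyps by (simp add: s_def)
  finally show ?case .
qed (simp_all add: pcong_refl)

lemma first_order_pcong_imp_pcong_1:
  assumes "first_order_pcong p k l u a" "j \<le> k" "j \<le> l"
  shows "pcong p j u 1"
proof -
  have "pcong p j u (1 + a * of_nat p ^ k)"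
    using assms(1,3) pcong_power_le unfolding first_order_pcong_def by blast
  also have "pcong p j \<dots> (1 + 0)"
    using assms(1,2) unfolding first_order_pcong_def
    by (intro pcong_add pcong_power_0 pcong_refl) auto
  finally show ?thesis by simp
qed

lemma first_order_pcong_imp_not_pcong_0:
  assumes "first_order_pcong p k l u a" "0 < k" "0 < l"
  shows "\<not> pcong p 1 u 0"
proof
  have "pcong p 1 u (of_nat 1)" using first_order_pcong_imp_pcong_1[OF assms(1)] assms(2,3) by simp
  then have "pcong p 1 (of_nat 1) u" by (rule pcong_sym)
  also assume "pcong p 1 u 0"
  finally have "pcong p 1 (of_nat 1) 0" .
  then show False using prime_gt_1_nat[OF prime_p] unfolding of_nat_pcong_0_iff by simp
qed

lemma first_order_pcong_coeff:
  assumes "first_order_pcong p k l u a" "pcong p m a b" "l \<le> m + k"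
  shows "first_order_pcong p k l u b"
proof -
  have "pcong p l (a * of_nat p ^ k) (b * of_nat p ^ k)"
    using pcong_mult_power[OF assms(2)] assms(3) by (rule pcong_power_le)
  then have "pcong p l (1 + a * of_nat p ^ k) (1 + b * of_nat p ^ k)"
    by (intro pcong_add pcong_refl p_integral_1)
  then show ?thesis
    using assms(1) pcong_imp_p_integral(2)[OF assms(2)] pcong_trans
    unfolding first_order_pcong_def by blast
qed

lemma first_order_pcong_mult:
  assumes "first_order_pcong p k l u a" "first_order_pcong p k l v b" "l \<le> 2 * k"
  shows "first_order_pcong p k l (u * v) (a + b)"
proof -
  have integral: "p_integral p a" "p_integral p b"
    using assms unfolding first_order_pcong_def by auto
  have "pcong p l (u * v) ((1 + a * of_nat p ^ k) * (1 + b * of_nat p ^ k))"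
    using assms unfolding first_order_pcong_def by (intro pcong_mult) auto
  also have "\<dots> = 1 + (a + b) * of_nat p ^ k + a * b * of_nat p ^ (2 * k)"
    by (simp add: algebra_simps power_mult power2_eq_square mult.commute[of _ k])
  also have "pcong p l \<dots> (1 + (a + b) * of_nat p ^ k + 0)"
    using assms(3) integral by (intro pcong_add pcong_power_0 pcong_refl p_integral_intros) auto
  finally show ?thesis
    using integral unfolding first_order_pcong_def by (simp add: p_integral_add)
qed

lemma first_order_pcong_one_plus:
  "p_integral p a \<Longrightarrow> first_order_pcong p k l (1 + a * of_nat p ^ k) a"
  unfolding first_order_pcong_def by (simp add: pcong_refl p_integral_intros)

lemma first_order_pcong_inverse:
  assumes "first_order_pcong p k l u a" "0 < k" "0 < l" "l \<le> 2 * k"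
  shows "first_order_pcong p k l (inverse u) (- a)"
proof -
  have u_integral: "p_integral p u" and a_integral: "p_integral p a"
    using assms(1) pcong_imp_p_integral unfolding first_order_pcong_def by auto
  have unit: "\<not> pcong p 1 u 0" by (rule first_order_pcong_imp_not_pcong_0[OF assms(1-3)])
  then have "u \<noteq> 0" using pcong_refl[OF p_integral_0] by blast
  have "first_order_pcong p k l (u * (1 + - a * of_nat p ^ k)) (a + - a)"
    using assms a_integral
    by (intro first_order_pcong_mult first_order_pcong_one_plus p_integral_minus)
  then have "pcong p l (u * inverse u) (u * (1 + - a * of_nat p ^ k))"
    using \<open>u \<noteq> 0\<close> pcong_sym unfolding first_order_pcong_def by simp
  then have "pcong p l (inverse u) (1 + - a * of_nat p ^ k)"
    using pcong_mult_left_cancel[OF u_integral unit] p_integral_inverse[OF u_integral unit] a_integral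
    by (simp add: p_integral_intros)
  then show ?thesis using a_integral unfolding first_order_pcong_def by (simp add: p_integral_minus)
qed

lemma first_order_pcong_divide:
  assumes "first_order_pcong p k l u a" "first_order_pcong p k l v b" "0 < k" "0 < l" "l \<le> 2 * k"
  shows "first_order_pcong p k l (u / v) (a - b)"
  using first_order_pcong_mult[OF assms(1) first_order_pcong_inverse[OF assms(2-5)] assms(5)]
  by (simp add: divide_inverse)

lemma first_order_pcong_prod:
  assumes "\<And>i. i \<in> A \<Longrightarrow> first_order_pcong p k l (u i) (a i)" "l \<le> 2 * k"
  shows "first_order_pcong p k l (prod u A) (sum a A)"
  using assms
proof (induction A rule: infinite_finite_induct)
  case (insert i A)
  then show ?case by (auto intro: first_order_pcong_mult)
qed (use first_order_pcong_one_plus[OF p_integral_0] in simp_all)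

lemma first_order_pcong_sqrt:
  assumes "first_order_pcong p k l (u\<^sup>2) (2 * a)" "pcong p 1 u 1" "p_integral p a"
    and "2 < p" "0 < k" "l \<le> 2 * k"
  shows "first_order_pcong p k l u a"
proof -
  define v where "v = 1 + a * of_nat p ^ k"
  have v_first_order: "first_order_pcong p k l v a"
    unfolding v_def by (rule first_order_pcong_one_plus[OF assms(3)])
  have integral: "p_integral p u" "p_integral p v"
    using pcong_imp_p_integral[OF assms(2)] assms(3) by (auto simp: v_def p_integral_intros)
  have "pcong p 1 v (1 + 0)"
    unfolding v_def using assms by (intro pcong_add pcong_power_0 pcong_refl) auto
  then have "pcong p 1 v 1" by simp
  from pcong_add[OF assms(2) this] have "pcong p 1 (of_nat 2) (u + v)" by (simp add: pcong_sym)
  moreover have "\<not> pcong p 1 (of_nat 2) 0"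
    unfolding of_nat_pcong_0_iff using assms(4) by (auto dest: dvd_imp_le)
  ultimately have unit: "\<not> pcong p 1 (u + v) 0" using pcong_trans by blast
  have "first_order_pcong p k l (v\<^sup>2) (2 * a)"
    using first_order_pcong_mult[OF v_first_order v_first_order assms(6)]
    by (simp add: power2_eq_square)
  then have "pcong p l (u\<^sup>2) (v\<^sup>2)"
    using assms(1) pcong_sym pcong_trans unfolding first_order_pcong_def by blast
  then have "pcong p l (u\<^sup>2 - v\<^sup>2) 0"
    using integral by (simp add: pcong_diff_0_iff p_integral_power)
  then have "pcong p l ((u + v) * (u - v)) ((u + v) * 0)"
    by (simp add: algebra_simps power2_eq_square)
  then have "pcong p l (u - v) 0"
    using integral
    by (subst (asm) pcong_mult_left_cancel[OF _ unit]) (auto intro: p_integral_intros)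
  then show ?thesis
    using integral assms(3) by (simp add: pcong_diff_0_iff first_order_pcong_def v_def)
qed

lemma first_order_pcong_prod_one_plus:
  assumes "2 < p" "0 < m" "\<And>i. i \<in> A \<Longrightarrow> p_integral p (t i)"
    and "pcong p 1 (sum t A) 0" "pcong p 1 (\<Sum>i\<in>A. (t i)\<^sup>2) 0"
  shows "first_order_pcong p m (2 * m + 1) (\<Prod>i\<in>A. 1 + t i * of_nat p ^ m) (sum t A)"
proof -
  define e where "e = ((sum t A)\<^sup>2 - (\<Sum>i\<in>A. (t i)\<^sup>2)) / 2"
  have half: "p_integral p (1 / 2)" using p_integral_divide_2[OF p_integral_1 assms(1)] .
  have "pcong p 1 (1 / 2 * ((sum t A)\<^sup>2 + (- 1) * (\<Sum>i\<in>A. (t i)\<^sup>2))) (1 / 2 * (0\<^sup>2 + (- 1) * 0))"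
    using assms(4,5)
    by (intro pcong_mult_left pcong_add pcong_power half p_integral_minus p_integral_1)
  then have "pcong p 1 e 0" by (simp add: e_def)
  from pcong_mult_power[OF this, of "2 * m"]
  have "pcong p (2 * m + 1) (e * of_nat p ^ (2 * m)) 0" by simp
  moreover have sum: "p_integral p (sum t A)" using assms(4) by (rule pcong_imp_p_integral)
  ultimately have "pcong p (2 * m + 1) (1 + sum t A * of_nat p ^ m + e * of_nat p ^ (2 * m))
      (1 + sum t A * of_nat p ^ m + 0)"
    by (intro pcong_add pcong_refl p_integral_add p_integral_mult p_integral_power p_integral_1
        p_integral_of_nat)
  moreover have "pcong p (2 * m + 1) (\<Prod>i\<in>A. 1 + t i * of_nat p ^ m)
      (1 + sum t A * of_nat p ^ m + e * of_nat p ^ (2 * m))"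
  proof (rule pcong_power_le)
    show "pcong p (3 * m) (\<Prod>i\<in>A. 1 + t i * of_nat p ^ m)
        (1 + sum t A * of_nat p ^ m + e * of_nat p ^ (2 * m))"
      unfolding e_def by (rule prod_one_plus_pcong[OF assms(1,3)])
  qed (use assms(2) in simp)
  ultimately show ?thesis using sum pcong_trans unfolding first_order_pcong_def by auto
qed

lemma first_order_pcong_gbinomial:
  assumes "p_integral p x" "m < p" "l \<le> 2 * k"
  shows "first_order_pcong p k l ((x * of_nat p ^ k + of_nat m) gchoose m) (x * H1 m)"
proof -
  have "first_order_pcong p k l (\<Prod>i=1..m. 1 + x / of_nat i * of_nat p ^ k) (\<Sum>i=1..m. x / of_nat i)"
    using assms
    by (intro first_order_pcong_prod first_order_pcong_one_plus p_integral_divide_of_nat_less) auto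
  then show ?thesis by (simp add: gbinomial_add_of_nat_eq_prod H1_def sum_distrib_left)
qed

lemma first_order_pcong_binomial:
  assumes "m < p" "l \<le> 2 * k"
  shows "first_order_pcong p k l (of_nat (X * p ^ k + m choose m)) (of_nat X * H1 m)"
  using first_order_pcong_gbinomial[OF p_integral_of_nat[of X] assms]
  by (simp add: binomial_gbinomial)

section \<open>Binomial coefficients of multiples of prime powers\<close>

lemma first_order_pcong_gbinomial_mult_pred_square:
  assumes "p \<ge> 7" "p_integral p x"
  shows "first_order_pcong p 3 5 (((x * of_nat p + of_nat (p - 1)) gchoose (p - 1))\<^sup>2)
    (2 * (x * (x + 1) * (H1 (p - 1) / of_nat p ^ 2)))"
proof -
  define c where "c = x * (x + 1)"
  define t where "t k = c * (1 / (of_nat k * of_nat (p - k)))" for k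
  have c_integral: "p_integral p c" unfolding c_def using assms(2) by (intro p_integral_intros) auto
  have t_integral: "p_integral p (t k)" if "k \<in> {1..p-1}" for k
  proof -
    have "p_integral p (c / of_nat k / of_nat (p - k))"
      using that c_integral by (intro p_integral_divide_of_nat_less) auto
    then show ?thesis by (simp add: t_def)
  qed
  have "\<not> (p - 1) dvd 2 * 1" "\<not> (p - 1) dvd 2 * 2" using assms(1) by (auto dest: dvd_imp_le)
  from this[THEN sum_inverse_mult_reflect_power_pcong_0]
  have "pcong p 1 (c * (\<Sum>k=1..p-1. (1 / (of_nat k * of_nat (p - k))) ^ 1)) (c * 0)"
    and "pcong p 1 (c\<^sup>2 * (\<Sum>k=1..p-1. (1 / (of_nat k * of_nat (p - k)))\<^sup>2)) (c\<^sup>2 * 0)"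
    using c_integral by (intro pcong_mult_left p_integral_power; simp)+
  then have "pcong p 1 (sum t {1..p-1}) 0" "pcong p 1 (\<Sum>k=1..p-1. (t k)\<^sup>2) 0"
    unfolding t_def power_mult_distrib sum_distrib_left by simp_all
  then have "first_order_pcong p 2 (2 * 2 + 1) (\<Prod>k=1..p-1. 1 + t k * of_nat p ^ 2) (sum t {1..p-1})"
    using t_integral assms(1) by (intro first_order_pcong_prod_one_plus) auto
  moreover have "((x * of_nat p + of_nat (p - 1)) gchoose (p - 1))\<^sup>2 =
      (\<Prod>k=1..p-1. 1 + t k * of_nat p ^ 2)"
    using gbinomial_mult_pred_square[of p x] assms(1) by (simp add: t_def c_def)
  moreover have "sum t {1..p-1} * of_nat p ^ 2 =
      2 * (c * (H1 (p - 1) / of_nat p ^ 2)) * of_nat p ^ 3"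
  proof -
    have "of_nat p * sum t {1..p-1} = c * (2 * H1 (p - 1))"
      unfolding t_def sum_distrib_left[symmetric] sum_inverse_mult_reflect[symmetric] by simp
    then show ?thesis using assms(1) by (simp add: power2_eq_square power3_eq_cube mult_ac)
  qed
  moreover have "p_integral p (2 * (c * (H1 (p - 1) / of_nat p ^ 2)))"
    using c_integral wolstenholme_harmonic assms(1)
    by (intro p_integral_mult p_integral_numeral) auto
  ultimately show ?thesis unfolding first_order_pcong_def c_def by simp
qed

lemma first_order_pcong_gbinomial_mult_pred:
  assumes "p \<ge> 7" "p_integral p x"
  shows "first_order_pcong p 3 5 ((x * of_nat p + of_nat (p - 1)) gchoose (p - 1))
    (of_int (wolst p) * (x * (x + 1)))"
proof -
  define c where "c = x * (x + 1)"
  define w where "w = H1 (p - 1) / of_nat p ^ 2"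
  define g where "g = (x * of_nat p + of_nat (p - 1)) gchoose (p - 1)"
  have c_integral: "p_integral p c" unfolding c_def using assms(2) by (intro p_integral_intros) auto
  have w_cong: "p_integral p w" "pcong p 2 (of_int (wolst p)) w"
    unfolding w_def using assms(1) by (intro wolstenholme_harmonic wolst_pcong; simp)+
  have "first_order_pcong p 3 5 (g\<^sup>2) (2 * (c * w))"
    unfolding g_def c_def w_def by (rule first_order_pcong_gbinomial_mult_pred_square[OF assms])
  moreover have "pcong p 1 g 1"
    using first_order_pcong_gbinomial[OF assms(2), of "p - 1" 1 1] assms(1)
    by (intro first_order_pcong_imp_pcong_1[of 1 1 g]) (auto simp: g_def)
  ultimately have "first_order_pcong p 3 5 g (c * w)"
    by (rule first_order_pcong_sqrt)
      (use assms(1) c_integral w_cong(1) in \<open>simp_all add: p_integral_mult\<close>)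
  moreover have "pcong p 2 (c * w) (c * of_int (wolst p))"
    by (rule pcong_mult_left[OF pcong_sym[OF w_cong(2)] c_integral])
  ultimately have "first_order_pcong p 3 5 g (c * of_int (wolst p))"
    by (rule first_order_pcong_coeff) simp
  then show ?thesis unfolding g_def c_def by (simp only: mult.commute)
qed

lemma first_order_pcong_block_prod:
  assumes "p \<ge> 7"
  shows "first_order_pcong p 3 5 (of_nat (block_prod p N))
    (of_int (wolst p) * ((of_nat N ^ 3 - of_nat N) / 3))"
proof -
  have "first_order_pcong p 3 5 (\<Prod>j<N. (of_nat j * of_nat p + of_nat (p - 1)) gchoose (p - 1))
      (\<Sum>j<N. of_int (wolst p) * (of_nat j * (of_nat j + 1)))"
    by (intro first_order_pcong_prod first_order_pcong_gbinomial_mult_pred assms p_integral_of_nat)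
      simp
  moreover have "(\<Sum>j<N. of_int (wolst p) * (of_nat j * (of_nat j + 1))) =
      of_int (wolst p) * ((of_nat N ^ 3 - of_nat N) / 3 :: rat)"
    by (induction N) (simp_all add: field_simps power3_eq_cube)
  ultimately show ?thesis by (simp add: block_prod_def binomial_gbinomial)
qed

lemma first_order_pcong_binomial_mult:
  assumes "p \<ge> 7" "R \<le> N"
  shows "first_order_pcong p 3 5 (of_nat (N * p choose (R * p)) / of_nat (N choose R))
    (jacobsthal_coeff p N R)"
proof -
  define b where "b X = rat_of_nat (block_prod p X)" for X
  define a where "a X = of_int (wolst p) * ((rat_of_nat X ^ 3 - of_nat X) / 3)" for X
  have b_first_order: "first_order_pcong p 3 5 (b X) (a X)" for X
    unfolding a_def b_def by (rule first_order_pcong_block_prod[OF assms(1)])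
  have "b X \<noteq> 0" for X by (simp add: b_def block_prod_def)
  then have "of_nat (N * p choose (R * p)) / of_nat (N choose R) = b N / b R / b (N - R)"
    using arg_cong[OF binomial_mult_mult_eq_block_prod[OF _ assms(2), of p], of rat_of_nat] assms
    by (simp add: b_def field_simps)
  moreover have "first_order_pcong p 3 5 (b N / b R / b (N - R)) (a N - a R - a (N - R))"
    by (intro first_order_pcong_divide b_first_order) simp_all
  moreover have "a N - a R - a (N - R) = jacobsthal_coeff p N R"
    using assms(2) by (simp add: a_def jacobsthal_coeff_def of_nat_diff field_simps power3_eq_cube)
  ultimately show ?thesis by simp
qed

lemma first_order_pcong_binomial_mult_power:
  assumes "p \<ge> 7" "R \<le> N" "0 < i"
  shows "first_order_pcong p 3 5 (of_nat (N * p ^ i choose (R * p ^ i)) / of_nat (N choose R))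
    (jacobsthal_coeff p N R)"
  using assms(3)
proof (induction i rule: nat_induct_non_zero)
  case 1
  then show ?case using first_order_pcong_binomial_mult[OF assms(1,2)] by simp
next
  case (Suc i)
  define b where "b j = rat_of_nat (N * p ^ j choose (R * p ^ j))" for j
  have "first_order_pcong p 3 5 (b (Suc i) / b i) (jacobsthal_coeff p N R * of_nat p ^ (3 * i))"
    using first_order_pcong_binomial_mult[of "R * p ^ i" "N * p ^ i"] assms
    by (simp add: jacobsthal_coeff_def b_def algebra_simps power_mult power3_eq_cube mult.commute[of 3])
  moreover have "pcong p 2 (jacobsthal_coeff p N R * of_nat p ^ (3 * i)) 0"
    using Suc.hyps
    by (intro pcong_power_0) (auto simp: jacobsthal_coeff_def intro!: p_integral_intros)
  ultimately have "first_order_pcong p 3 5 (b (Suc i) / b i) 0"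
    by (rule first_order_pcong_coeff) simp
  with Suc.IH have "first_order_pcong p 3 5 (b i / of_nat (N choose R) * (b (Suc i) / b i))
      (jacobsthal_coeff p N R + 0)"
    unfolding b_def by (intro first_order_pcong_mult) simp_all
  moreover have "b i \<noteq> 0" using assms(2) by (simp add: b_def)
  ultimately show ?case using assms(2) by (simp add: b_def)
qed

lemma first_order_pcong_binomial_mult_add_le:
  assumes "p \<ge> 7" "R \<le> N" "n < p" "r \<le> n"
  shows "first_order_pcong p 3 5
    (of_nat (N * p ^ 3 + n choose (R * p ^ 3 + r)) / (of_nat (N choose R) * of_nat (n choose r)))
    (c_coeff N R n r p)"
proof -
  define b where "b X m = rat_of_nat (X * p ^ 3 + m choose m)" for X m
  define q where "q = rat_of_nat (N * p ^ 3 choose (R * p ^ 3)) / of_nat (N choose R)"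
  have b_first_order: "first_order_pcong p 3 5 (b X m) (of_nat X * H1 m)" if "m < p" for X m
    unfolding b_def using that by (rule first_order_pcong_binomial) simp
  have "first_order_pcong p 3 5 (q * b N n / b R r / b (N - R) (n - r))
    (jacobsthal_coeff p N R + of_nat N * H1 n
      - of_nat R * H1 r - of_nat (N - R) * H1 (n - r))"
    unfolding q_def using assms
    by (intro first_order_pcong_divide first_order_pcong_mult b_first_order
        first_order_pcong_binomial_mult_power)
      simp_all
  moreover have "of_nat (N * p ^ 3 + n choose (R * p ^ 3 + r)) /
      (of_nat (N choose R) * of_nat (n choose r)) =
      q * b N n / b R r / b (N - R) (n - r)"
  proof -
    have "R * p ^ 3 \<le> N * p ^ 3" using assms(2) by simp
    from arg_cong[OF binomial_add_add_le[OF this assms(4)], of rat_of_nat]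
    have "of_nat (N * p ^ 3 + n choose (R * p ^ 3 + r)) * b R r * b (N - R) (n - r) =
        of_nat (N * p ^ 3 choose (R * p ^ 3)) * of_nat (n choose r) * b N n"
      by (simp add: b_def diff_mult_distrib)
    moreover have "b R r \<noteq> 0" "b (N - R) (n - r) \<noteq> 0" by (simp_all add: b_def)
    ultimately show ?thesis using assms by (simp add: q_def field_simps)
  qed
  moreover have "jacobsthal_coeff p N R + of_nat N * H1 n
      - of_nat R * H1 r - of_nat (N - R) * H1 (n - r) = c_coeff N R n r p"
    using assms(2) by (simp add: c_coeff_def jacobsthal_coeff_def of_nat_diff algebra_simps)
  ultimately show ?thesis by simp
qed

lemma p_integral_inverse_binomial:
  assumes "k \<le> m" "m < p"
  shows "p_integral p (inverse (of_nat (m choose k)))"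
proof -
  have "\<not> p dvd fact m" using assms(2) prime_dvd_fact_iff[OF prime_p] by simp
  then have "\<not> p dvd m choose k"
    using binomial_fact_lemma[OF assms(1)] by (metis dvd_mult)
  then show ?thesis
    by (intro p_integral_inverse)
      (simp_all only: p_integral_of_nat of_nat_pcong_0_iff not_False_eq_True)
qed

lemma binomial_quotient_pcong_1:
  assumes "p \<ge> 7" "R \<le> N" "n < p" "r < p" "d < p"
  shows "pcong p 3 (of_nat (N * p ^ 3 choose (R * p ^ 3)) / of_nat (N choose R) *
    (of_nat (N * p ^ 3 + n choose n) * ((of_nat d - of_nat ((N - R) * p ^ 3)) gchoose d)
      / of_nat (R * p ^ 3 + r choose r))) 1"
proof -
  define b where "b X m = rat_of_nat (X * p ^ 3 + m choose m)" for X m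
  define D where "D = rat_of_nat (N - R)"
  define g where "g = (- D * of_nat p ^ 3 + of_nat d) gchoose d"
  define q where "q = rat_of_nat (N * p ^ 3 choose (R * p ^ 3)) / of_nat (N choose R)"
  have b_first_order: "first_order_pcong p 3 3 (b X m) (of_nat X * H1 m)" if "m < p" for X m
    unfolding b_def using that by (rule first_order_pcong_binomial) simp
  have "first_order_pcong p 3 5 q (jacobsthal_coeff p N R)"
    unfolding q_def using assms(1,2) by (rule first_order_pcong_binomial_mult_power) simp
  then have "pcong p 3 q 1" by (rule first_order_pcong_imp_pcong_1) simp_all
  moreover have "first_order_pcong p 3 3 (b N n * g / b R r)
      (of_nat N * H1 n + - D * H1 d - of_nat R * H1 r)"
    unfolding g_def D_def using assms
    by (intro first_order_pcong_divide first_order_pcong_mult b_first_order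
        first_order_pcong_gbinomial p_integral_minus p_integral_of_nat) simp_all
  then have "pcong p 3 (b N n * g / b R r) 1" by (rule first_order_pcong_imp_pcong_1) simp_all
  ultimately have "pcong p 3 (q * (b N n * g / b R r)) (1 * 1)" by (rule pcong_mult)
  then show ?thesis by (simp add: q_def b_def g_def D_def del: of_nat_diff)
qed

lemma binomial_mult_add_pcong_gt:
  assumes "p \<ge> 7" "R \<le> N" "r < p" "n < r"
  shows "pcong p 6
    (of_nat (N * p ^ 3 + n choose (R * p ^ 3 + r)) / of_nat (N choose R))
    ((- 1) ^ (r - n + 1) * ((of_nat N - of_nat R) / of_nat r)
      * inverse (of_nat (r - 1 choose n)) * of_nat p ^ 3)"
proof -
  define d where "d = r - n - 1"
  define q where "q = rat_of_nat (N * p ^ 3 choose (R * p ^ 3)) / of_nat (N choose R)"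
  define v where "v = rat_of_nat (N * p ^ 3 + n choose n)
    * ((of_nat d - of_nat ((N - R) * p ^ 3)) gchoose d) / of_nat (R * p ^ 3 + r choose r)"
  define \<kappa> where "\<kappa> = (- 1) ^ (r - n + 1) * ((rat_of_nat N - of_nat R) / of_nat r)
    * inverse (of_nat (r - 1 choose n))"
  have "p_integral p \<kappa>"
    unfolding \<kappa>_def using assms
    by (intro p_integral_mult p_integral_power p_integral_divide_of_nat_less
        p_integral_inverse_binomial p_integral_diff p_integral_minus p_integral_of_nat p_integral_1)
      auto
  moreover have "pcong p 3 (q * v) 1"
    unfolding q_def v_def using assms by (intro binomial_quotient_pcong_1) (simp_all add: d_def)
  ultimately have "pcong p (3 + 3) (\<kappa> * (q * v) * of_nat p ^ 3) (\<kappa> * 1 * of_nat p ^ 3)"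
    by (intro pcong_mult_power pcong_mult_left)
  moreover have "of_nat (N * p ^ 3 + n choose (R * p ^ 3 + r)) / of_nat (N choose R) =
      \<kappa> * (q * v) * of_nat p ^ 3"
  proof -
    have "R * p ^ 3 \<le> N * p ^ 3" using assms(2) by simp
    moreover have "r - n + 1 = d + 2" using assms(4) by (simp add: d_def)
    then have "\<kappa> * of_nat p ^ 3 = (- 1) ^ d * (of_nat ((N - R) * p ^ 3) / of_nat r)
        * inverse (of_nat (r - 1 choose n))"
      using assms(2) by (simp add: \<kappa>_def of_nat_diff)
    ultimately have "of_nat (N * p ^ 3 + n choose (R * p ^ 3 + r)) /
        of_nat (N * p ^ 3 choose (R * p ^ 3)) = \<kappa> * of_nat p ^ 3 * v"
      using binomial_add_add_gt_quotient[of "R * p ^ 3" "N * p ^ 3" n r, where 'a = rat] assms(4)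
      by (simp only: v_def d_def diff_mult_distrib)
    moreover have "of_nat (N * p ^ 3 choose (R * p ^ 3)) \<noteq> (0 :: rat)" using assms(2) by simp
    ultimately show ?thesis by (simp add: q_def field_simps)
  qed
  ultimately show ?thesis by (simp add: \<kappa>_def)
qed

end

theorem theorem3p5:
  fixes p N R n r :: nat
  assumes "prime p" and "p \<ge> 7" and "N \<ge> R" and "n < p" and "r < p"
  shows "(r \<le> n \<longrightarrow>
            pcong p 5
              (of_nat ((N * p ^ 3 + n) choose (R * p ^ 3 + r))
                 / (of_nat (N choose R) * of_nat (n choose r)))
              (1 + c_coeff N R n r p * of_nat p ^ 3)) \<and>
         (n < r \<longrightarrow>
            pcong p 5
              (of_nat ((N * p ^ 3 + n) choose (R * p ^ 3 + r)) / of_nat (N choose R))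
              ((-1) ^ (r - n + 1) * ((of_nat N - of_nat R) / of_nat r)
                 * inverse (of_nat ((r - 1) choose n)) * of_nat p ^ 3))"
proof (intro conjI impI)
  assume "r \<le> n"
  with assms show "pcong p 5
      (of_nat ((N * p ^ 3 + n) choose (R * p ^ 3 + r)) / (of_nat (N choose R) * of_nat (n choose r)))
      (1 + c_coeff N R n r p * of_nat p ^ 3)"
    using first_order_pcong_binomial_mult_add_le unfolding first_order_pcong_def by blast
next
  assume "n < r"
  with assms show "pcong p 5
      (of_nat ((N * p ^ 3 + n) choose (R * p ^ 3 + r)) / of_nat (N choose R))
      ((-1) ^ (r - n + 1) * ((of_nat N - of_nat R) / of_nat r)
        * inverse (of_nat ((r - 1) choose n)) * of_nat p ^ 3)"
    by (intro pcong_power_le[OF _ binomial_mult_add_pcong_gt]) simp_all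
qed

end
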